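(* Let $T$ be a first-order $L$-theory. There is a bitotal iso-bisimulation between the potentialist systems $\mathrm{Mod}(T)$ and $\mathrm{ModEm}(T)$.
   Context: A potentialist system is a collection (possibly a proper class) of first-order $L$-structures, called worlds, together with a collection of embeddings between them, containing the identity embeddings and all compositions of embeddings. "$\pi\colon M\to M'$ in $\mathcal M$" means that $\pi$ is one of the embeddings of $\mathcal M$. $\mathrm{Mod}(T)$ is the system consisting of the class of all models of $T$ together with all and only the substructure inclusion maps $M\subseteq N$. $\mathrm{ModEm}(T)$ is the system consisting of the class of all models of $T$ together with all embeddings of $L$-structures between them. An iso-bisimulation between potentialist systems $\mathcal M$ and $\mathcal N$ is a non-empty relation $\approx$ between the worlds of $\mathcal M$ and the worlds of $\mathcal N$, together with a system of isomorphisms $(\xi_{M,N}\colon M\to N \mid M\approx N)$ (one for each related pair), subject to the following condition. Whenever $\pi\colon M\to M'$ in $\mathcal M$ and $M\approx N$, there is $\rho\colon N\to N'$ in $\mathcal N$ such that $M'\approx N'$ and $\xi_{M',N'}\circ\pi=\rho\circ\xi_{M,N}$; and vice versa (whenever $\rho\colon N\to N'$ in $\mathcal N$ and $M\approx N$, there is $\pi\colon M\to M'$ in $\mathcal M$ such that $M'\approx N'$ and $\xi_{M',N'}\circ\pi=\rho\circ\xi_{M,N}$). It is bitotal if every world of $\mathcal M$ is related to some world of $\mathcal N$ and every world of $\mathcal N$ is related to some world of $\mathcal M$.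
   Formalization: Each related pair carries a non-empty set of isomorphisms, with back-and-forth required for each, instead of exactly one (with one, the claim fails if a model of T has a nontrivial automorphism); T is assumed to have a model, since the relation must be non-empty. *)

theory Defs
  imports "HOL-Library.FuncSet" "HOL-Library.Equipollence"
begin

section \<open>First-order logic with equality\<close>

text \<open>Function symbols of arity 0 serve as constants. The symbols of a language are given by sets,
  since HOL types are non-empty and a language may lack function or relation symbols.\<close>

record ('f, 'r) lang =
  Funs :: "'f set"
  Rels :: "'r set"
  farity :: "'f \<Rightarrow> nat"
  rarity :: "'r \<Rightarrow> nat"

datatype 'f trm = Var nat | Fn 'f "'f trm list"

datatype ('f, 'r) fm =
    Eq "'f trm" "'f trm"
  | Rel 'r "'f trm list"
  | Neg "('f, 'r) fm"
  | Conj "('f, 'r) fm" "('f, 'r) fm"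
  | All nat "('f, 'r) fm"

primrec wf_trm :: "('f, 'r) lang \<Rightarrow> 'f trm \<Rightarrow> bool" where
  "wf_trm L (Var n) \<longleftrightarrow> True"
| "wf_trm L (Fn f ts) \<longleftrightarrow> f \<in> Funs L \<and> length ts = farity L f \<and> list_all (wf_trm L) ts"

primrec wf_fm :: "('f, 'r) lang \<Rightarrow> ('f, 'r) fm \<Rightarrow> bool" where
  "wf_fm L (Eq t u) \<longleftrightarrow> wf_trm L t \<and> wf_trm L u"
| "wf_fm L (Rel r ts) \<longleftrightarrow> r \<in> Rels L \<and> length ts = rarity L r \<and> list_all (wf_trm L) ts"
| "wf_fm L (Neg p) \<longleftrightarrow> wf_fm L p"
| "wf_fm L (Conj p q) \<longleftrightarrow> wf_fm L p \<and> wf_fm L q"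
| "wf_fm L (All n p) \<longleftrightarrow> wf_fm L p"

primrec fv_trm :: "'f trm \<Rightarrow> nat set" where
  "fv_trm (Var n) = {n}"
| "fv_trm (Fn f ts) = \<Union> (set (map fv_trm ts))"

primrec fv_fm :: "('f, 'r) fm \<Rightarrow> nat set" where
  "fv_fm (Eq t u) = fv_trm t \<union> fv_trm u"
| "fv_fm (Rel r ts) = \<Union> (set (map fv_trm ts))"
| "fv_fm (Neg p) = fv_fm p"
| "fv_fm (Conj p q) = fv_fm p \<union> fv_fm q"
| "fv_fm (All n p) = fv_fm p - {n}"

definition sentence :: "('f, 'r) lang \<Rightarrow> ('f, 'r) fm \<Rightarrow> bool" where
  "sentence L p \<longleftrightarrow> wf_fm L p \<and> fv_fm p = {}"

definition fo_theory :: "('f, 'r) lang \<Rightarrow> ('f, 'r) fm set \<Rightarrow> bool" where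
  "fo_theory L T \<longleftrightarrow> (\<forall>p\<in>T. sentence L p)"

section \<open>Structures and embeddings\<close>

record ('f, 'r, 'u) struct =
  dom :: "'u set"
  fint :: "'f \<Rightarrow> 'u list \<Rightarrow> 'u"
  rint :: "'r \<Rightarrow> 'u list \<Rightarrow> bool"

definition tuples :: "'u set \<Rightarrow> nat \<Rightarrow> 'u list set" where
  "tuples A n = {xs. set xs \<subseteq> A \<and> length xs = n}"

text \<open>The last two clauses fix the values of the interpretations at arguments that carry no
  information, so that structures are equal in HOL exactly if they are the same structure.\<close>

definition is_structure :: "('f, 'r) lang \<Rightarrow> ('f, 'r, 'u) struct \<Rightarrow> bool" where
  "is_structure L M \<longleftrightarrow>
     dom M \<noteq> {} \<and>
     (\<forall>f\<in>Funs L. \<forall>xs\<in>tuples (dom M) (farity L f). fint M f xs \<in> dom M) \<and>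
     (\<forall>f xs. \<not> (f \<in> Funs L \<and> xs \<in> tuples (dom M) (farity L f)) \<longrightarrow> fint M f xs = undefined) \<and>
     (\<forall>r xs. \<not> (r \<in> Rels L \<and> xs \<in> tuples (dom M) (rarity L r)) \<longrightarrow> \<not> rint M r xs)"

text \<open>Maps between structures are extensional functions on the domain; their composition is
  \<^const>\<open>compose\<close> and the inclusion of a subset is the restricted identity.\<close>

definition embedding ::
  "('f, 'r) lang \<Rightarrow> ('f, 'r, 'a) struct \<Rightarrow> ('f, 'r, 'b) struct \<Rightarrow> ('a \<Rightarrow> 'b) \<Rightarrow> bool" where
  "embedding L M N h \<longleftrightarrow>
     h \<in> dom M \<rightarrow>\<^sub>E dom N \<and> inj_on h (dom M) \<and>
     (\<forall>f\<in>Funs L. \<forall>xs\<in>tuples (dom M) (farity L f). h (fint M f xs) = fint N f (map h xs)) \<and>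
     (\<forall>r\<in>Rels L. \<forall>xs\<in>tuples (dom M) (rarity L r). rint M r xs \<longleftrightarrow> rint N r (map h xs))"

definition isomorphism ::
  "('f, 'r) lang \<Rightarrow> ('f, 'r, 'a) struct \<Rightarrow> ('f, 'r, 'b) struct \<Rightarrow> ('a \<Rightarrow> 'b) \<Rightarrow> bool" where
  "isomorphism L M N h \<longleftrightarrow> embedding L M N h \<and> h ` dom M = dom N"

definition substructure ::
  "('f, 'r) lang \<Rightarrow> ('f, 'r, 'u) struct \<Rightarrow> ('f, 'r, 'u) struct \<Rightarrow> bool" where
  "substructure L M N \<longleftrightarrow>
     dom M \<subseteq> dom N \<and>
     (\<forall>f\<in>Funs L. \<forall>xs\<in>tuples (dom M) (farity L f). fint M f xs = fint N f xs) \<and>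
     (\<forall>r\<in>Rels L. \<forall>xs\<in>tuples (dom M) (rarity L r). rint M r xs \<longleftrightarrow> rint N r xs)"

section \<open>Satisfaction\<close>

primrec eval_trm :: "('f, 'r, 'u) struct \<Rightarrow> (nat \<Rightarrow> 'u) \<Rightarrow> 'f trm \<Rightarrow> 'u" where
  "eval_trm M s (Var n) = s n"
| "eval_trm M s (Fn f ts) = fint M f (map (eval_trm M s) ts)"

primrec sat :: "('f, 'r, 'u) struct \<Rightarrow> (nat \<Rightarrow> 'u) \<Rightarrow> ('f, 'r) fm \<Rightarrow> bool" where
  "sat M s (Eq t u) \<longleftrightarrow> eval_trm M s t = eval_trm M s u"
| "sat M s (Rel r ts) \<longleftrightarrow> rint M r (map (eval_trm M s) ts)"
| "sat M s (Neg p) \<longleftrightarrow> \<not> sat M s p"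
| "sat M s (Conj p q) \<longleftrightarrow> sat M s p \<and> sat M s q"
| "sat M s (All n p) \<longleftrightarrow> (\<forall>x\<in>dom M. sat M (s(n := x)) p)"

definition satisfies :: "('f, 'r, 'u) struct \<Rightarrow> ('f, 'r) fm set \<Rightarrow> bool" where
  "satisfies M T \<longleftrightarrow> (\<forall>p\<in>T. \<forall>s. range s \<subseteq> dom M \<longrightarrow> sat M s p)"

text \<open>The type \<open>'u\<close> plays the role of the universe of sets. As in von Neumann's axiom of
  limitation of size, a subclass of the universe is a set iff it is strictly smaller than the
  universe, and the domain of a structure has to be a set. Hence the class of all models of
  a theory is the following collection. Some size restriction is indispensable: a structure whose
  domain is all of \<open>'u\<close> has no proper extension within \<open>'u\<close>.\<close>

definition Models :: "('f, 'r) lang \<Rightarrow> ('f, 'r) fm set \<Rightarrow> ('f, 'r, 'u) struct set" where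
  "Models L T = {M. is_structure L M \<and> dom M \<prec> (UNIV :: 'u set) \<and> satisfies M T}"

section \<open>Potentialist systems\<close>

text \<open>A triple \<open>(M, \<pi>, M')\<close> in \<open>embs S\<close> means that \<open>\<pi> : M \<rightarrow> M'\<close> in \<open>S\<close>.\<close>

record ('f, 'r, 'u) psystem =
  worlds :: "('f, 'r, 'u) struct set"
  embs :: "(('f, 'r, 'u) struct \<times> ('u \<Rightarrow> 'u) \<times> ('f, 'r, 'u) struct) set"

definition incl :: "('f, 'r, 'u) struct \<Rightarrow> 'u \<Rightarrow> 'u" where
  "incl M = restrict (\<lambda>x. x) (dom M)"

definition potentialist_system :: "('f, 'r) lang \<Rightarrow> ('f, 'r, 'u) psystem \<Rightarrow> bool" where
  "potentialist_system L S \<longleftrightarrow>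
     (\<forall>M\<in>worlds S. is_structure L M) \<and>
     (\<forall>M h N. (M, h, N) \<in> embs S \<longrightarrow> M \<in> worlds S \<and> N \<in> worlds S \<and> embedding L M N h) \<and>
     (\<forall>M\<in>worlds S. (M, incl M, M) \<in> embs S) \<and>
     (\<forall>M h N k P. (M, h, N) \<in> embs S \<and> (N, k, P) \<in> embs S
        \<longrightarrow> (M, compose (dom M) k h, P) \<in> embs S)"

definition Mod :: "('f, 'r) lang \<Rightarrow> ('f, 'r) fm set \<Rightarrow> ('f, 'r, 'u) psystem" where
  "Mod L T =
     \<lparr>worlds = Models L T,
      embs = {(M, h, N). M \<in> Models L T \<and> N \<in> Models L T \<and> substructure L M N \<and> h = incl M}\<rparr>"

definition ModEm :: "('f, 'r) lang \<Rightarrow> ('f, 'r) fm set \<Rightarrow> ('f, 'r, 'u) psystem" where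
  "ModEm L T =
     \<lparr>worlds = Models L T,
      embs = {(M, h, N). M \<in> Models L T \<and> N \<in> Models L T \<and> embedding L M N h}\<rparr>"

section \<open>Iso-bisimulations\<close>

text \<open>\<open>R\<close> is the relation between worlds and \<open>Xi M N\<close> is the non-empty set of isomorphisms through
  which \<open>M\<close> and \<open>N\<close> are related; the back-and-forth conditions are imposed on each
  isomorphism in it. A pair may thus be related through several isomorphisms. Requiring a single one,
  namely that every \<open>Xi M N\<close> be a singleton, would be too restrictive: by
  \<open>single_isomorphism_imp_rigid\<close> below, a bitotal iso-bisimulation between \<open>Mod L T\<close> and
  \<open>ModEm L T\<close> would then exist only if no model of \<open>T\<close> has a non-trivial automorphism.\<close>

definition iso_bisimulation ::
  "('f, 'r) lang \<Rightarrow> ('f, 'r, 'a) psystem \<Rightarrow> ('f, 'r, 'b) psystem \<Rightarrow>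
   (('f, 'r, 'a) struct \<Rightarrow> ('f, 'r, 'b) struct \<Rightarrow> bool) \<Rightarrow>
   (('f, 'r, 'a) struct \<Rightarrow> ('f, 'r, 'b) struct \<Rightarrow> ('a \<Rightarrow> 'b) set) \<Rightarrow> bool" where
  "iso_bisimulation L S S' R Xi \<longleftrightarrow>
     potentialist_system L S \<and> potentialist_system L S' \<and>
     (\<exists>M N. R M N) \<and>
     (\<forall>M N. R M N \<longrightarrow> M \<in> worlds S \<and> N \<in> worlds S' \<and> Xi M N \<noteq> {} \<and>
        (\<forall>\<xi>\<in>Xi M N. isomorphism L M N \<xi>)) \<and>
     (\<forall>M N \<xi> M' \<pi>. R M N \<and> \<xi> \<in> Xi M N \<and> (M, \<pi>, M') \<in> embs S \<longrightarrow>
        (\<exists>N' \<rho> \<xi>'. (N, \<rho>, N') \<in> embs S' \<and> R M' N' \<and> \<xi>' \<in> Xi M' N' \<and>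
           compose (dom M) \<xi>' \<pi> = compose (dom M) \<rho> \<xi>)) \<and>
     (\<forall>M N \<xi> N' \<rho>. R M N \<and> \<xi> \<in> Xi M N \<and> (N, \<rho>, N') \<in> embs S' \<longrightarrow>
        (\<exists>M' \<pi> \<xi>'. (M, \<pi>, M') \<in> embs S \<and> R M' N' \<and> \<xi>' \<in> Xi M' N' \<and>
           compose (dom M) \<xi>' \<pi> = compose (dom M) \<rho> \<xi>))"

definition bitotal_on ::
  "('f, 'r, 'a) psystem \<Rightarrow> ('f, 'r, 'b) psystem \<Rightarrow>
   (('f, 'r, 'a) struct \<Rightarrow> ('f, 'r, 'b) struct \<Rightarrow> bool) \<Rightarrow> bool" where
  "bitotal_on S S' R \<longleftrightarrow>
     (\<forall>M\<in>worlds S. \<exists>N\<in>worlds S'. R M N) \<and> (\<forall>N\<in>worlds S'. \<exists>M\<in>worlds S. R M N)"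

lemma single_isomorphism_imp_rigid:
  fixes N :: "('f, 'r, 'u) struct"
    and R :: "('f, 'r, 'u) struct \<Rightarrow> ('f, 'r, 'u) struct \<Rightarrow> bool"
  assumes bis: "iso_bisimulation L (Mod L T) (ModEm L T) R Xi"
    and bit: "bitotal_on (Mod L T) (ModEm L T) R"
    and single: "\<And>M N. R M N \<Longrightarrow> \<exists>\<xi>. Xi M N = {\<xi>}"
    and N: "N \<in> Models L T" and h: "isomorphism L N N h" and y: "y \<in> dom N"
  shows "h y = y"
proof -
  obtain M where R: "R M N"
    using bit N by (auto simp: bitotal_on_def Mod_def ModEm_def)
  obtain \<xi> where Xi: "Xi M N = {\<xi>}" using single[OF R] by blast
  have iso: "isomorphism L M N \<xi>" and M: "M \<in> Models L T"
    using bis R Xi unfolding iso_bisimulation_def Mod_def by auto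
  have bk: "\<forall>M N \<xi> N' \<rho>. R M N \<and> \<xi> \<in> Xi M N \<and> (N, \<rho>, N') \<in> embs (ModEm L T) \<longrightarrow>
        (\<exists>M' \<pi> \<xi>'. (M, \<pi>, M') \<in> embs (Mod L T) \<and> R M' N' \<and> \<xi>' \<in> Xi M' N' \<and>
           compose (dom M) \<xi>' \<pi> = compose (dom M) \<rho> \<xi>)"
    using bis unfolding iso_bisimulation_def by blast
  have "(N, h, N) \<in> embs (ModEm L T)"
    using N h by (simp add: ModEm_def isomorphism_def)
  with bk R Xi obtain M' \<pi> \<xi>' where
    e: "(M, \<pi>, M') \<in> embs (Mod L T)" and R': "R M' N" and Xi': "\<xi>' \<in> Xi M' N"
    and eq: "compose (dom M) \<xi>' \<pi> = compose (dom M) h \<xi>"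
    by (metis singletonI)
  have sub: "substructure L M M'" and M': "M' \<in> Models L T" and \<pi>: "\<pi> = incl M"
    using e by (auto simp: Mod_def)
  have iso': "isomorphism L M' N \<xi>'"
    using bis R' Xi' unfolding iso_bisimulation_def by auto
  have eq': "\<xi>' x = h (\<xi> x)" if "x \<in> dom M" for x
    using fun_cong[OF eq, of x] that \<pi> by (simp add: compose_def incl_def)
  have "dom M' = dom M"
  proof
    show "dom M \<subseteq> dom M'" using sub by (simp add: substructure_def)
    show "dom M' \<subseteq> dom M"
    proof
      fix x assume x: "x \<in> dom M'"
      then have "\<xi>' x \<in> h ` \<xi> ` dom M"
        using iso iso' h by (auto simp: isomorphism_def)
      then obtain z where "z \<in> dom M" "\<xi>' x = \<xi>' z" using eq' by auto
      moreover have "inj_on \<xi>' (dom M')" using iso' by (simp add: isomorphism_def embedding_def)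
      ultimately show "x \<in> dom M" using x sub by (auto simp: substructure_def inj_on_def)
    qed
  qed
  with sub M M' have "M' = M"
  proof -
    have "fint M' = fint M" "rint M' = rint M"
      using sub M M' \<open>dom M' = dom M\<close>
      unfolding substructure_def Models_def is_structure_def fun_eq_iff mem_Collect_eq by metis+
    with \<open>dom M' = dom M\<close> show ?thesis by (cases M; cases M') auto
  qed
  then have "\<xi>' = \<xi>" using Xi Xi' by simp
  obtain x where "x \<in> dom M" "y = \<xi> x" using y iso by (auto simp: isomorphism_def)
  with eq' \<open>\<xi>' = \<xi>\<close> show ?thesis by simp
qed

end

theory Submission
  imports Defs
begin

text \<open>
  Relate two models when they are isomorphic, through all isomorphisms between them. This relation
  is bitotal because every model is isomorphic to itself. All isomorphisms are admitted because
  the one that continues a given \<open>\<xi> : M \<rightarrow> N\<close> at a later pair of worlds is determined on \<open>M\<close>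
  by \<open>\<xi>\<close> and the embeddings chosen, and not by the two worlds alone.

  An inclusion \<open>M \<subseteq> M'\<close> is answered from \<open>\<xi> : M \<rightarrow> N\<close> without building a new model: the
  world \<open>M'\<close> is itself a world of the other system, where it can be reached from \<open>N\<close> by the
  embedding \<open>\<xi>\<inverse>\<close> followed by the inclusion, so the identity of \<open>M'\<close> is a suitable new
  isomorphism.

  In the other direction, an embedding \<open>\<rho> : N \<rightarrow> N'\<close> must be turned into a genuine
  superstructure of \<open>M\<close>. The elements of \<open>N'\<close> in the image of \<open>\<rho> \<circ> \<xi>\<close> are renamed to their
  preimages in \<open>M\<close>, and the others are renamed to elements outside \<open>M\<close>. The structure of \<open>N'\<close> is
  then pulled back along this renaming (\<open>embedding_factors_through_superstructure\<close>), and it remains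
  a model of the theory because satisfaction is invariant under isomorphism
  (\<open>isomorphism_sat\<close>). That there are enough elements outside \<open>M\<close> is the content of
  \<open>extend_injection_to_bijection\<close>: if there were fewer than needed, they could be injected into the
  part of \<open>N'\<close> outside the image, and together with \<open>\<rho> \<circ> \<xi>\<close> this would inject the
  whole universe into \<open>N'\<close>, whose domain is smaller than the universe.
\<close>

section \<open>Embeddings and isomorphisms\<close>

lemma map_in_tuples: "h ` A \<subseteq> B \<Longrightarrow> xs \<in> tuples A n \<Longrightarrow> map h xs \<in> tuples B n"
  by (auto simp: tuples_def)

lemma embedding_into:
  assumes "embedding L M N h" shows "h ` dom M \<subseteq> dom N"
  using assms by (auto simp: embedding_def)

lemma embedding_compose:
  assumes M: "is_structure L M" and h: "embedding L M N h" and k: "embedding L N P k"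
  shows "embedding L M P (compose (dom M) k h)"
proof -
  have map_eq: "map (compose (dom M) k h) xs = map k (map h xs)" if "xs \<in> tuples (dom M) n" for xs n
    using that by (auto simp: tuples_def compose_def)
  have tup: "map h xs \<in> tuples (dom N) n" if "xs \<in> tuples (dom M) n" for xs n
    using that map_in_tuples[OF embedding_into[OF h]] by blast
  have "compose (dom M) k h \<in> dom M \<rightarrow>\<^sub>E dom P"
    using h k by (auto simp: embedding_def compose_def)
  moreover have "inj_on (compose (dom M) k h) (dom M)"
    using h k by (auto simp: embedding_def compose_def inj_on_def PiE_def Pi_def)
  moreover have "compose (dom M) k h (fint M f xs) = fint P f (map (compose (dom M) k h) xs)"
    if f: "f \<in> Funs L" and xs: "xs \<in> tuples (dom M) (farity L f)" for f xs
  proof -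
    have "fint M f xs \<in> dom M" using M f xs by (simp add: is_structure_def)
    then show ?thesis
      using h k f xs tup[OF xs] by (simp add: embedding_def map_eq[OF xs] compose_eq del: map_map)
  qed
  moreover have "rint M r xs \<longleftrightarrow> rint P r (map (compose (dom M) k h) xs)"
    if r: "r \<in> Rels L" and xs: "xs \<in> tuples (dom M) (rarity L r)" for r xs
    using h k r xs tup[OF xs] by (simp add: embedding_def map_eq[OF xs] del: map_map)
  ultimately show ?thesis by (simp add: embedding_def)
qed

lemma embedding_incl_iff_substructure:
  assumes M: "is_structure L M"
  shows "embedding L M N (incl M) \<longleftrightarrow> substructure L M N"
proof -
  have map_eq: "map (incl M) xs = xs" if "xs \<in> tuples (dom M) n" for xs n
    using that by (intro map_idI) (auto simp: tuples_def incl_def)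
  have "incl M \<in> dom M \<rightarrow>\<^sub>E dom N \<longleftrightarrow> dom M \<subseteq> dom N"
    by (auto simp: incl_def PiE_def Pi_def)
  moreover have "inj_on (incl M) (dom M)"
    by (simp add: incl_def inj_on_def)
  moreover have "incl M (fint M f xs) = fint M f xs"
    if "f \<in> Funs L" "xs \<in> tuples (dom M) (farity L f)" for f xs
    using M that by (simp add: is_structure_def incl_def)
  ultimately show ?thesis
    by (simp add: embedding_def substructure_def map_eq)
qed

lemma isomorphism_incl: "is_structure L M \<Longrightarrow> isomorphism L M M (incl M)"
  by (simp add: isomorphism_def embedding_incl_iff_substructure substructure_def)
    (simp add: incl_def)

lemma isomorphism_inverse:
  assumes M: "is_structure L M" and h: "isomorphism L M N h"
  shows "isomorphism L N M (restrict (inv_into (dom M) h) (dom N))" (is "isomorphism L N M ?k")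
proof -
  have emb: "embedding L M N h" and bij: "bij_betw h (dom M) (dom N)"
    using h by (auto simp: isomorphism_def embedding_def bij_betw_def)
  have kh: "?k (h x) = x" if "x \<in> dom M" for x
    using that bij by (auto simp: bij_betw_def)
  have bij': "bij_betw ?k (dom N) (dom M)"
    using bij_betw_inv_into[OF bij] by (simp cong: bij_betw_cong)
  \<comment> \<open>Tuples of \<open>N\<close> are the images of tuples of \<open>M\<close>, so the clauses for \<open>h\<close> can be read backwards.\<close>
  have lift: "\<exists>xs\<in>tuples (dom M) n. ys = map h xs \<and> map ?k ys = xs"
    if ys: "ys \<in> tuples (dom N) n" for ys n
  proof
    have hk: "h (?k y) = y" and "?k y \<in> dom M" if "y \<in> dom N" for y
      using that bij by (auto simp: bij_betw_def f_inv_into_f inv_into_into)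
    with ys show "map ?k ys \<in> tuples (dom M) n" and "ys = map h (map ?k ys) \<and> map ?k ys = map ?k ys"
      by (auto simp: tuples_def intro!: map_idI[symmetric])
  qed
  have "?k (fint N f ys) = fint M f (map ?k ys)"
    if f: "f \<in> Funs L" and ys: "ys \<in> tuples (dom N) (farity L f)" for f ys
  proof -
    obtain xs where xs: "xs \<in> tuples (dom M) (farity L f)" "ys = map h xs" "map ?k ys = xs"
      using lift[OF ys] by blast
    have "fint M f xs \<in> dom M" using M f xs by (simp add: is_structure_def)
    moreover have "fint N f ys = h (fint M f xs)"
      using emb f xs by (simp add: embedding_def)
    ultimately show ?thesis using kh xs(3) by simp
  qed
  moreover have "rint N r ys \<longleftrightarrow> rint M r (map ?k ys)"
    if r: "r \<in> Rels L" and ys: "ys \<in> tuples (dom N) (rarity L r)" for r ys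
  proof -
    obtain xs where xs: "xs \<in> tuples (dom M) (rarity L r)" "ys = map h xs" "map ?k ys = xs"
      using lift[OF ys] by blast
    with emb r show ?thesis by (simp add: embedding_def)
  qed
  ultimately show ?thesis
    using bij' by (auto simp: isomorphism_def embedding_def bij_betw_def)
qed

section \<open>Invariance of satisfaction under isomorphism\<close>

lemma eval_trm_in_dom:
  assumes "is_structure L M" and "range s \<subseteq> dom M" and "wf_trm L t"
  shows "eval_trm M s t \<in> dom M"
  using assms(3)
proof (induction t)
  case (Var n)
  then show ?case using assms(2) by auto
next
  case (Fn f ts)
  then have "map (eval_trm M s) ts \<in> tuples (dom M) (farity L f)"
    by (auto simp: tuples_def list_all_iff)
  then show ?case using Fn.prems assms(1) by (simp add: is_structure_def)
qed

lemma map_eval_trm_in_tuples: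
  assumes "is_structure L M" and "range s \<subseteq> dom M" and "list_all (wf_trm L) ts"
  shows "map (eval_trm M s) ts \<in> tuples (dom M) (length ts)"
  using assms by (auto simp: tuples_def list_all_iff intro: eval_trm_in_dom)

lemma embedding_eval_trm:
  assumes "is_structure L M" and "embedding L M N h" and "range s \<subseteq> dom M" and "wf_trm L t"
  shows "eval_trm N (\<lambda>n. h (s n)) t = h (eval_trm M s t)"
  using assms(4)
proof (induction t)
  case (Var n)
  then show ?case by simp
next
  case (Fn f ts)
  then have "map (eval_trm N (\<lambda>n. h (s n))) ts = map h (map (eval_trm M s) ts)"
    by (simp add: list_all_iff)
  moreover have "map (eval_trm M s) ts \<in> tuples (dom M) (farity L f)"
    using map_eval_trm_in_tuples[OF assms(1,3), of ts] Fn.prems by simp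
  ultimately show ?case
    using Fn.prems assms(2) by (simp add: embedding_def del: map_map)
qed

lemma isomorphism_sat:
  assumes M: "is_structure L M" and h: "isomorphism L M N h"
    and "wf_fm L p" and "range s \<subseteq> dom M"
  shows "sat N (\<lambda>n. h (s n)) p \<longleftrightarrow> sat M s p"
  using assms(3,4)
proof (induction p arbitrary: s)
  have emb: "embedding L M N h" and onto: "h ` dom M = dom N"
    using h by (auto simp: isomorphism_def)
  note eval = embedding_eval_trm[OF M emb]
  {
    case (Eq t u)
    have "inj_on h (dom M)" using emb by (simp add: embedding_def)
    moreover have "eval_trm M s t \<in> dom M" "eval_trm M s u \<in> dom M"
      using Eq.prems eval_trm_in_dom[OF M] by auto
    ultimately show ?case
      using Eq.prems by (simp add: eval inj_on_eq_iff)
  next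
    case (Rel r ts)
    then have "map (eval_trm N (\<lambda>n. h (s n))) ts = map h (map (eval_trm M s) ts)"
      by (auto simp: list_all_iff eval)
    moreover have "map (eval_trm M s) ts \<in> tuples (dom M) (rarity L r)"
      using map_eval_trm_in_tuples[OF M Rel.prems(2), of ts] Rel.prems(1) by simp
    ultimately show ?case
      using Rel.prems(1) emb by (simp add: embedding_def del: map_map)
  next
    case (All n p)
    have "sat N ((\<lambda>m. h (s m))(n := h x)) p \<longleftrightarrow> sat M (s(n := x)) p" if "x \<in> dom M" for x
    proof -
      have range: "range (s(n := x)) \<subseteq> dom M" using All.prems that by auto
      have "sat N (\<lambda>m. h ((s(n := x)) m)) p \<longleftrightarrow> sat M (s(n := x)) p"
        using All.IH[OF _ range] All.prems(1) by (simp only: wf_fm.simps)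
      moreover have "(\<lambda>m. h (s m))(n := h x) = (\<lambda>m. h ((s(n := x)) m))" by auto
      ultimately show ?thesis by (simp only:)
    qed
    then show ?case by (simp add: onto[symmetric])
  }
qed simp_all

lemma isomorphic_model:
  fixes M N :: "('f, 'r, 'u) struct"
  assumes T: "fo_theory L T" and M: "is_structure L M" and h: "isomorphism L M N h"
    and N: "N \<in> Models L T"
  shows "M \<in> Models L T"
proof -
  have into: "h ` dom M = dom N" and inj: "inj_on h (dom M)"
    using h by (auto simp: isomorphism_def embedding_def)
  have "dom M \<approx> dom N"
    using into inj by (auto simp: eqpoll_def bij_betw_def)
  moreover have "dom N \<prec> (UNIV :: 'u set)"
    using N by (simp add: Models_def)
  ultimately have "dom M \<prec> (UNIV :: 'u set)"
    by (rule eq_lesspoll_trans)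
  moreover have "sat M s p" if p: "p \<in> T" and s: "range s \<subseteq> dom M" for p s
  proof -
    have "range (\<lambda>n. h (s n)) \<subseteq> dom N" using s into by auto
    then have "sat N (\<lambda>n. h (s n)) p" using N p by (simp add: Models_def satisfies_def)
    moreover have "wf_fm L p" using T p by (simp add: fo_theory_def sentence_def)
    ultimately show ?thesis using isomorphism_sat[OF M h _ s] by simp
  qed
  ultimately show ?thesis using M by (simp add: Models_def satisfies_def)
qed

section \<open>Turning an embedding into an inclusion\<close>

text \<open>Comparability of cardinals replaces any cardinal arithmetic here, so finite and infinite
  universes need no separate treatment.\<close>

lemma extend_injection_to_bijection:
  fixes A :: "'a set" and B :: "'b set"
  assumes inj: "inj_on g A" and into: "g ` A \<subseteq> B" and small: "B \<prec> (UNIV :: 'a set)"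
  obtains A' h where "A \<subseteq> A'" and "bij_betw h A' B" and "\<And>x. x \<in> A \<Longrightarrow> h x = g x"
proof -
  consider (room) f where "f ` (B - g ` A) \<subseteq> - A" "inj_on f (B - g ` A)"
    | (no_room) f where "f ` (- A) \<subseteq> B - g ` A" "inj_on f (- A)"
    using ordLeq_total[OF card_of_Well_order card_of_Well_order, of "B - g ` A" "- A"]
    unfolding card_of_ordLeq[symmetric] by blast
  then show thesis
  proof cases
    case room
    let ?D = "B - g ` A"
    let ?h = "\<lambda>x. if x \<in> A then g x else inv_into ?D f x"
    have "bij_betw (inv_into ?D f) (f ` ?D) ?D"
      using room(2) by (simp add: bij_betw_inv_into inj_on_imp_bij_betw)
    then have "bij_betw ?h (f ` ?D) ?D"
      using room(1) by (subst bij_betw_cong[where g = "inv_into ?D f"]) auto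
    moreover have "bij_betw ?h A (g ` A)"
      using inj by (subst bij_betw_cong[where g = g]) (auto simp: bij_betw_def)
    ultimately have "bij_betw ?h (A \<union> f ` ?D) (g ` A \<union> ?D)"
      by (intro bij_betw_combine) auto
    moreover have "g ` A \<union> ?D = B" using into by blast
    ultimately show ?thesis using that[of "A \<union> f ` ?D" ?h] by auto
  next
    case no_room
    let ?k = "\<lambda>x. if x \<in> A then g x else f x"
    have "inj ?k"
      using inj no_room by (auto simp: inj_on_def)
    moreover have "range ?k \<subseteq> B" using into no_room(1) by auto
    ultimately have "(UNIV :: 'a set) \<lesssim> B" unfolding lepoll_def by blast
    with small show ?thesis
      using lesspoll_trans2 by blast
  qed
qed

text \<open>Outside the tuples over \<open>A\<close> the interpretations take the default values that
  \<^const>\<open>is_structure\<close> prescribes.\<close>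

definition pullback_structure ::
  "('f, 'r) lang \<Rightarrow> 'a set \<Rightarrow> ('a \<Rightarrow> 'b) \<Rightarrow> ('f, 'r, 'b) struct \<Rightarrow> ('f, 'r, 'a) struct" where
  "pullback_structure L A h N =
     \<lparr>dom = A,
      fint = \<lambda>f xs. if f \<in> Funs L \<and> xs \<in> tuples A (farity L f)
                    then inv_into A h (fint N f (map h xs)) else undefined,
      rint = \<lambda>r xs. r \<in> Rels L \<and> xs \<in> tuples A (rarity L r) \<and> rint N r (map h xs)\<rparr>"

lemma pullback_structure_isomorphism:
  assumes N: "is_structure L N" and h: "bij_betw h A (dom N)"
  defines "M \<equiv> pullback_structure L A h N"
  shows "is_structure L M" and "isomorphism L M N (restrict h A)"
proof -
  have onto: "h ` A = dom N" and inj: "inj_on h A"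
    using h by (auto simp: bij_betw_def)
  have val: "fint N f (map h xs) \<in> h ` A"
    if "f \<in> Funs L" "xs \<in> tuples A (farity L f)" for f xs
    using N that map_in_tuples[of h A "dom N" xs] by (simp add: is_structure_def onto)
  have map_eq: "map (restrict h A) xs = map h xs" if "xs \<in> tuples A n" for xs n
    using that by (auto simp: tuples_def)
  have "A \<noteq> {}" using N onto by (auto simp: is_structure_def)
  then show "is_structure L M"
    using inv_into_into[OF val] by (auto simp: is_structure_def M_def pullback_structure_def)
  show "isomorphism L M N (restrict h A)"
    using onto inj inv_into_into[OF val] f_inv_into_f[OF val]
    by (auto simp: isomorphism_def embedding_def M_def pullback_structure_def map_eq)
qed

text \<open>Since the bijection onto \<open>dom N\<close> extends \<open>g\<close>, pulling \<open>N\<close> back along it undoes \<open>g\<close> on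
  \<open>M\<close>, and what is left of the embedding is an inclusion.\<close>

lemma embedding_factors_through_superstructure:
  fixes M N :: "('f, 'r, 'u) struct"
  assumes T: "fo_theory L T" and M: "is_structure L M" and N: "N \<in> Models L T"
    and g: "embedding L M N g"
  obtains M' h where "M' \<in> Models L T" and "substructure L M M'" and "isomorphism L M' N h"
    and "compose (dom M) h (incl M) = g"
proof -
  have strN: "is_structure L N" and small: "dom N \<prec> (UNIV :: 'u set)"
    using N by (auto simp: Models_def)
  have "inj_on g (dom M)" using g by (simp add: embedding_def)
  then obtain A h where sub: "dom M \<subseteq> A" and bij: "bij_betw h A (dom N)"
    and h_eq: "\<And>x. x \<in> dom M \<Longrightarrow> h x = g x"
    using extend_injection_to_bijection[OF _ embedding_into[OF g] small] by blast
  define M' where "M' = pullback_structure L A h N"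
  have strM': "is_structure L M'" and iso: "isomorphism L M' N (restrict h A)"
    using pullback_structure_isomorphism[OF strN bij] by (auto simp: M'_def)
  have map_eq: "map h xs = map g xs" and tup: "xs \<in> tuples A n"
    if "xs \<in> tuples (dom M) n" for xs n
    using that sub h_eq by (auto simp: tuples_def)
  have "fint M f xs = fint M' f xs"
    if f: "f \<in> Funs L" and xs: "xs \<in> tuples (dom M) (farity L f)" for f xs
  proof -
    have y: "fint M f xs \<in> dom M" using M f xs by (simp add: is_structure_def)
    have "fint N f (map h xs) = h (fint M f xs)"
      using g f xs by (simp add: map_eq[OF xs] h_eq[OF y] embedding_def)
    moreover have "inv_into A h (h (fint M f xs)) = fint M f xs"
      using y sub bij by (auto simp: bij_betw_def)
    ultimately show ?thesis
      using f tup[OF xs] by (simp add: M'_def pullback_structure_def)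
  qed
  moreover have "rint M r xs \<longleftrightarrow> rint M' r xs"
    if r: "r \<in> Rels L" and xs: "xs \<in> tuples (dom M) (rarity L r)" for r xs
    using g r xs tup[OF xs]
    by (simp add: M'_def pullback_structure_def map_eq[OF xs] embedding_def)
  ultimately have "substructure L M M'"
    using sub by (auto simp: substructure_def M'_def pullback_structure_def)
  moreover have "compose (dom M) (restrict h A) (incl M) = g"
  proof
    fix x
    show "compose (dom M) (restrict h A) (incl M) x = g x"
      using g sub h_eq
      by (cases "x \<in> dom M") (auto simp: compose_def incl_def embedding_def PiE_def extensional_def)
  qed
  ultimately show thesis
    using that isomorphic_model[OF T strM' iso N] iso by blast
qed

section \<open>The iso-bisimulation\<close>

lemma Models_is_structure: "M \<in> Models L T \<Longrightarrow> is_structure L M"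
  by (simp add: Models_def)

lemma substructure_refl: "substructure L M M"
  by (simp add: substructure_def)

lemma substructure_trans:
  assumes MN: "substructure L M N" and NP: "substructure L N P"
  shows "substructure L M P"
proof -
  have tup: "xs \<in> tuples (dom N) n" if "xs \<in> tuples (dom M) n" for xs n
    using that MN by (auto simp: substructure_def tuples_def)
  have "fint M f xs = fint P f xs" if "f \<in> Funs L" "xs \<in> tuples (dom M) (farity L f)" for f xs
    using MN NP that tup[OF that(2)] unfolding substructure_def by simp
  moreover have "rint M r xs \<longleftrightarrow> rint P r xs"
    if "r \<in> Rels L" "xs \<in> tuples (dom M) (rarity L r)" for r xs
    using MN NP that tup[OF that(2)] unfolding substructure_def by simp
  moreover have "dom M \<subseteq> dom P" using MN NP unfolding substructure_def by blast
  ultimately show ?thesis unfolding substructure_def by blast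
qed

lemma potentialist_system_Mod: "potentialist_system L (Mod L T)"
proof -
  have "compose (dom M) (incl N) (incl M) = incl M" if "substructure L M N" for M N
  proof -
    have "dom M \<subseteq> dom N" using that by (simp add: substructure_def)
    then show ?thesis by (auto simp: compose_def incl_def restrict_def fun_eq_iff)
  qed
  then show ?thesis
    unfolding potentialist_system_def Mod_def
    by (auto simp: Models_is_structure embedding_incl_iff_substructure substructure_refl
        intro: substructure_trans)
qed

lemma potentialist_system_ModEm: "potentialist_system L (ModEm L T)"
proof -
  have "embedding L M M (incl M)" if "M \<in> Models L T" for M
    using isomorphism_incl[OF Models_is_structure[OF that]] by (simp add: isomorphism_def)
  moreover have "embedding L M P (compose (dom M) k h)"
    if "M \<in> Models L T" "embedding L M N h" "embedding L N P k" for M N P h k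
    using embedding_compose[OF Models_is_structure] that by blast
  ultimately show ?thesis
    by (simp add: potentialist_system_def ModEm_def Models_is_structure) blast
qed

theorem theorem28:
  fixes L :: "('f, 'r) lang" and T :: "('f, 'r) fm set"
  assumes "fo_theory L T"
    and "(Models L T :: ('f, 'r, 'u) struct set) \<noteq> {}"
  shows "\<exists>R Xi. iso_bisimulation L (Mod L T :: ('f, 'r, 'u) psystem)
                  (ModEm L T :: ('f, 'r, 'u) psystem) R Xi \<and>
                bitotal_on (Mod L T) (ModEm L T) R"
proof -
  let ?K = "Models L T :: ('f, 'r, 'u) struct set"
  define Xi :: "('f, 'r, 'u) struct \<Rightarrow> ('f, 'r, 'u) struct \<Rightarrow> ('u \<Rightarrow> 'u) set"
    where "Xi = (\<lambda>M N. Collect (isomorphism L M N))"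
  define R where "R = (\<lambda>M N. M \<in> ?K \<and> N \<in> ?K \<and> Xi M N \<noteq> {})"
  have refl: "R M M" if "M \<in> ?K" for M
    using that isomorphism_incl[OF Models_is_structure] by (auto simp: R_def Xi_def)
  have zig: "\<exists>N' \<rho> \<xi>'. (N, \<rho>, N') \<in> embs (ModEm L T) \<and> R M' N' \<and> \<xi>' \<in> Xi M' N' \<and>
      compose (dom M) \<xi>' \<pi> = compose (dom M) \<rho> \<xi>"
    if RMN: "R M N" and \<xi>: "\<xi> \<in> Xi M N" and \<pi>: "(M, \<pi>, M') \<in> embs (Mod L T)" for M N \<xi> M' \<pi>
  proof -
    have M: "is_structure L M" and N: "N \<in> ?K" and iso: "isomorphism L M N \<xi>"
      using RMN \<xi> by (auto simp: R_def Xi_def Models_is_structure)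
    have M': "M' \<in> ?K" and sub: "substructure L M M'" and \<pi>_eq: "\<pi> = incl M"
      using \<pi> by (auto simp: Mod_def)
    define \<eta> where "\<eta> = restrict (inv_into (dom M) \<xi>) (dom N)"
    define \<rho> where "\<rho> = compose (dom N) (incl M) \<eta>"
    have "embedding L N M \<eta>"
      using isomorphism_inverse[OF M iso] by (simp add: \<eta>_def isomorphism_def)
    moreover have "embedding L M M' (incl M)"
      using embedding_incl_iff_substructure[OF M] sub by blast
    ultimately have "embedding L N M' \<rho>"
      unfolding \<rho>_def by (rule embedding_compose[OF Models_is_structure[OF N]])
    then have "(N, \<rho>, M') \<in> embs (ModEm L T)"
      using N M' by (simp add: ModEm_def)
    moreover have "compose (dom M) (incl M') \<pi> = compose (dom M) \<rho> \<xi>"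
      using iso sub
      by (auto simp: fun_eq_iff compose_def \<pi>_eq incl_def \<rho>_def \<eta>_def substructure_def
          isomorphism_def embedding_def)
    moreover have "incl M' \<in> Xi M' M'"
      using isomorphism_incl[OF Models_is_structure[OF M']] by (simp add: Xi_def)
    ultimately show ?thesis using refl[OF M'] by blast
  qed
  have zag: "\<exists>M' \<pi> \<xi>'. (M, \<pi>, M') \<in> embs (Mod L T) \<and> R M' N' \<and> \<xi>' \<in> Xi M' N' \<and>
      compose (dom M) \<xi>' \<pi> = compose (dom M) \<rho> \<xi>"
    if RMN: "R M N" and \<xi>: "\<xi> \<in> Xi M N" and \<rho>: "(N, \<rho>, N') \<in> embs (ModEm L T)" for M N \<xi> N' \<rho>
  proof -
    have M: "M \<in> ?K" and iso: "isomorphism L M N \<xi>"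
      using RMN \<xi> by (auto simp: R_def Xi_def)
    have N': "N' \<in> ?K" and emb: "embedding L N N' \<rho>"
      using \<rho> by (auto simp: ModEm_def)
    have "embedding L M N' (compose (dom M) \<rho> \<xi>)"
      using embedding_compose[OF Models_is_structure[OF M]] iso emb by (auto simp: isomorphism_def)
    then obtain M' \<xi>' where "M' \<in> ?K" "substructure L M M'" "isomorphism L M' N' \<xi>'"
      "compose (dom M) \<xi>' (incl M) = compose (dom M) \<rho> \<xi>"
      using embedding_factors_through_superstructure[OF assms(1) Models_is_structure[OF M] N'] by blast
    then show ?thesis using M N' by (auto simp: Mod_def R_def Xi_def)
  qed
  have worlds: "worlds (Mod L T) = ?K" "worlds (ModEm L T) = ?K"
    by (auto simp: Mod_def ModEm_def)
  have nonempty: "\<exists>M N. R M N" using assms(2) refl by blast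
  have related: "R M N \<longrightarrow> M \<in> worlds (Mod L T) \<and> N \<in> worlds (ModEm L T) \<and> Xi M N \<noteq> {} \<and>
      (\<forall>\<xi>\<in>Xi M N. isomorphism L M N \<xi>)" for M N
    unfolding worlds R_def by (auto simp: Xi_def)
  have "iso_bisimulation L (Mod L T) (ModEm L T) R Xi"
    unfolding iso_bisimulation_def
    by (intro conjI allI impI potentialist_system_Mod potentialist_system_ModEm nonempty
        related[rule_format]) (blast intro: zig zag dest: related[rule_format])+
  moreover have "bitotal_on (Mod L T) (ModEm L T) R"
    unfolding bitotal_on_def worlds using refl by blast
  ultimately show ?thesis by blast
qed

end
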